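(* There are continuum-many ($2^{\aleph_0}$) normal monomodal logics $L$ with $KU_1\subseteq L\subseteq K5_2$.
   Context: Monomodal formulas are built from countably many atoms $q_0,q_1,\dots$ using $\top,\neg,\vee,\Diamond$, with $\Box\varphi=\neg\Diamond\neg\varphi$. A normal modal logic is a set of formulas containing all propositional tautologies, $\Box(p\to q)\to(\Box p\to\Box q)$ and $\Diamond p\leftrightarrow\neg\Box\neg p$, closed under modus ponens, generalisation and uniform substitution. $KU_1$ is the smallest normal modal logic containing $\Box(\Box q_0\to\Box q_1)\vee\Box(\Box q_1\to\Box q_0)$; $K5_2$ is the smallest normal modal logic containing $\Diamond\Diamond p\to\Box\Diamond p$. *)

theory Defs
  imports Main "HOL-Library.Equipollence"
begin

datatype fm =
    Atom nat
  | Top  (\<open>\<^bold>\<top>\<close>)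
  | Neg fm  (\<open>\<^bold>\<not> _\<close> [70] 70)
  | Dis fm fm  (infixr \<open>\<^bold>\<or>\<close> 60)
  | Dia fm  (\<open>\<^bold>\<diamond> _\<close> [70] 70)

abbreviation Con :: "fm \<Rightarrow> fm \<Rightarrow> fm"  (infixr \<open>\<^bold>\<and>\<close> 65)
  where "\<phi> \<^bold>\<and> \<psi> \<equiv> \<^bold>\<not> (\<^bold>\<not> \<phi> \<^bold>\<or> \<^bold>\<not> \<psi>)"

abbreviation Imp :: "fm \<Rightarrow> fm \<Rightarrow> fm"  (infixr \<open>\<^bold>\<longrightarrow>\<close> 55)
  where "\<phi> \<^bold>\<longrightarrow> \<psi> \<equiv> \<^bold>\<not> \<phi> \<^bold>\<or> \<psi>"

abbreviation Iff :: "fm \<Rightarrow> fm \<Rightarrow> fm"  (infixr \<open>\<^bold>\<longleftrightarrow>\<close> 50)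
  where "\<phi> \<^bold>\<longleftrightarrow> \<psi> \<equiv> (\<phi> \<^bold>\<longrightarrow> \<psi>) \<^bold>\<and> (\<psi> \<^bold>\<longrightarrow> \<phi>)"

abbreviation Box :: "fm \<Rightarrow> fm"  (\<open>\<^bold>\<box> _\<close> [70] 70)
  where "\<^bold>\<box> \<phi> \<equiv> \<^bold>\<not> \<^bold>\<diamond> \<^bold>\<not> \<phi>"

primrec subst :: "(nat \<Rightarrow> fm) \<Rightarrow> fm \<Rightarrow> fm" where
  "subst \<sigma> (Atom i) = \<sigma> i"
| "subst \<sigma> \<^bold>\<top> = \<^bold>\<top>"
| "subst \<sigma> (\<^bold>\<not> \<phi>) = \<^bold>\<not> (subst \<sigma> \<phi>)"
| "subst \<sigma> (\<phi> \<^bold>\<or> \<psi>) = subst \<sigma> \<phi> \<^bold>\<or> subst \<sigma> \<psi>"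
| "subst \<sigma> (\<^bold>\<diamond> \<phi>) = \<^bold>\<diamond> (subst \<sigma> \<phi>)"

text \<open>A propositional tautology may contain modalities: formulas of the form
  \<open>\<^bold>\<diamond> \<phi>\<close> are treated as further propositional variables, with truth values given by \<open>d\<close>.\<close>

primrec prop_eval :: "(nat \<Rightarrow> bool) \<Rightarrow> (fm \<Rightarrow> bool) \<Rightarrow> fm \<Rightarrow> bool" where
  "prop_eval v d (Atom i) \<longleftrightarrow> v i"
| "prop_eval v d \<^bold>\<top> \<longleftrightarrow> True"
| "prop_eval v d (\<^bold>\<not> \<phi>) \<longleftrightarrow> \<not> prop_eval v d \<phi>"
| "prop_eval v d (\<phi> \<^bold>\<or> \<psi>) \<longleftrightarrow> prop_eval v d \<phi> \<or> prop_eval v d \<psi>"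
| "prop_eval v d (\<^bold>\<diamond> \<phi>) \<longleftrightarrow> d \<phi>"

definition tautology :: "fm \<Rightarrow> bool"
  where "tautology \<phi> \<longleftrightarrow> (\<forall>v d. prop_eval v d \<phi>)"

definition normal_logic :: "fm set \<Rightarrow> bool" where
  "normal_logic L \<longleftrightarrow>
     (\<forall>\<phi>. tautology \<phi> \<longrightarrow> \<phi> \<in> L) \<and>
     (\<^bold>\<box> (Atom 0 \<^bold>\<longrightarrow> Atom 1) \<^bold>\<longrightarrow> (\<^bold>\<box> Atom 0 \<^bold>\<longrightarrow> \<^bold>\<box> Atom 1)) \<in> L \<and>
     (\<^bold>\<diamond> Atom 0 \<^bold>\<longleftrightarrow> \<^bold>\<not> \<^bold>\<box> \<^bold>\<not> Atom 0) \<in> L \<and>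
     (\<forall>\<phi> \<psi>. \<phi> \<in> L \<longrightarrow> (\<phi> \<^bold>\<longrightarrow> \<psi>) \<in> L \<longrightarrow> \<psi> \<in> L) \<and>
     (\<forall>\<phi>. \<phi> \<in> L \<longrightarrow> \<^bold>\<box> \<phi> \<in> L) \<and>
     (\<forall>\<phi> \<sigma>. \<phi> \<in> L \<longrightarrow> subst \<sigma> \<phi> \<in> L)"

definition smallest_logic :: "fm \<Rightarrow> fm set"
  where "smallest_logic \<alpha> = \<Inter> {L. normal_logic L \<and> \<alpha> \<in> L}"

lemma normal_logic_smallest_logic: "normal_logic (smallest_logic \<alpha>)"
  unfolding smallest_logic_def normal_logic_def by blast

lemma axiom_in_smallest_logic: "\<alpha> \<in> smallest_logic \<alpha>"
  unfolding smallest_logic_def by blast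

lemma smallest_logic_least: "normal_logic L \<Longrightarrow> \<alpha> \<in> L \<Longrightarrow> smallest_logic \<alpha> \<subseteq> L"
  unfolding smallest_logic_def by blast

definition KU1 :: "fm set" where
  "KU1 = smallest_logic
     (\<^bold>\<box> (\<^bold>\<box> Atom 0 \<^bold>\<longrightarrow> \<^bold>\<box> Atom 1) \<^bold>\<or> \<^bold>\<box> (\<^bold>\<box> Atom 1 \<^bold>\<longrightarrow> \<^bold>\<box> Atom 0))"

definition K5_2 :: "fm set" where
  "K5_2 = smallest_logic (\<^bold>\<diamond> \<^bold>\<diamond> Atom 0 \<^bold>\<longrightarrow> \<^bold>\<box> \<^bold>\<diamond> Atom 0)"

end

theory Submission
  imports Defs "HOL-Library.Countable"
begin

text \<open>
  On Kripke frames the axiom of \<open>KU1\<close> says that the successor sets of any two siblings are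
  comparable under inclusion, and the axiom of \<open>K5_2\<close> says that they coincide. There is ample room
  between these conditions. Let the frame \<open>F n\<close> (\<open>shortcut n\<close> below) be the infinite descending line
  \<open>\<dots> \<rightarrow> 2 \<rightarrow> 1 \<rightarrow> 0\<close> on the natural numbers with one shortcut \<open>n + 2 \<rightarrow> 0\<close>. Only \<open>n + 2\<close> has two
  successors, namely \<open>n + 1\<close> and the dead end \<open>0\<close>. The successor set of \<open>0\<close> is empty and that
  of \<open>n + 1\<close> is not, so \<open>F n\<close> validates \<open>KU1\<close>, while \<open>K5_2\<close> fails at \<open>n + 2\<close> and nowhere else.

  A variable-free formula recognises which frame the failure occurs in: the paths from \<open>n + 2\<close> to a
  dead end have lengths \<open>1\<close> and \<open>n + 2\<close>, so \<open>\<diamond>\<^sup>k\<^sup>+\<^sup>2 \<box>\<bottom>\<close> holds at the failure point of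
  \<open>F n\<close> exactly when \<open>k = n\<close>. Weakening the axiom of \<open>K5_2\<close> by this premise gives a formula that
  lies in \<open>K5_2\<close>, by propositional logic alone, and that is valid in every frame \<open>F n\<close> except
  for \<open>n = k\<close>. Hence the logics obtained by intersecting \<open>K5_2\<close> with the logics of \<open>F n\<close> for
  \<open>n \<in> S\<close> lie in the interval and are pairwise distinct for distinct sets \<open>S\<close> of natural numbers
  (\<open>weak5_in_interval_logic_iff\<close>). There are no more than continuum-many logics because there are only
  countably many formulas.
\<close>

section \<open>Kripke frames and their logics\<close>

primrec sat :: "('w \<Rightarrow> 'w \<Rightarrow> bool) \<Rightarrow> (nat \<Rightarrow> 'w \<Rightarrow> bool) \<Rightarrow> 'w \<Rightarrow> fm \<Rightarrow> bool" where
  "sat R V w (Atom i) \<longleftrightarrow> V i w"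
| "sat R V w \<^bold>\<top> \<longleftrightarrow> True"
| "sat R V w (\<^bold>\<not> \<phi>) \<longleftrightarrow> \<not> sat R V w \<phi>"
| "sat R V w (\<phi> \<^bold>\<or> \<psi>) \<longleftrightarrow> sat R V w \<phi> \<or> sat R V w \<psi>"
| "sat R V w (\<^bold>\<diamond> \<phi>) \<longleftrightarrow> (\<exists>u. R w u \<and> sat R V u \<phi>)"

definition frame_logic :: "('w \<Rightarrow> 'w \<Rightarrow> bool) \<Rightarrow> fm set" where
  "frame_logic R = {\<phi>. \<forall>V w. sat R V w \<phi>}"

text \<open>The bridge to tautologies: at a fixed world, the truth values of the diamond formulas form one
  particular valuation of them as propositional variables.\<close>

lemma sat_eq_prop_eval:
  "sat R V w \<phi> \<longleftrightarrow> prop_eval (\<lambda>i. V i w) (\<lambda>\<psi>. \<exists>u. R w u \<and> sat R V u \<psi>) \<phi>"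
  by (induction \<phi>) auto

lemma sat_subst:
  "sat R V w (subst \<sigma> \<phi>) \<longleftrightarrow> sat R (\<lambda>i u. sat R V u (\<sigma> i)) w \<phi>"
  by (induction \<phi> arbitrary: w) auto

lemma normal_logic_frame_logic: "normal_logic (frame_logic R)"
proof -
  have "\<phi> \<in> frame_logic R" if "tautology \<phi>" for \<phi>
    using that sat_eq_prop_eval[of R _ _ \<phi>] by (simp add: frame_logic_def tautology_def)
  moreover have "subst \<sigma> \<phi> \<in> frame_logic R" if "\<phi> \<in> frame_logic R" for \<sigma> \<phi>
    using that by (simp add: frame_logic_def sat_subst)
  ultimately show ?thesis
    unfolding normal_logic_def by (auto simp: frame_logic_def)
qed

lemma KU1_subset_frame_logic:
  assumes "\<And>x y z. R x y \<Longrightarrow> R x z \<Longrightarrow> Collect (R y) \<subseteq> Collect (R z) \<or> Collect (R z) \<subseteq> Collect (R y)"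
  shows "KU1 \<subseteq> frame_logic R"
  unfolding KU1_def
proof (intro smallest_logic_least normal_logic_frame_logic)
  show "\<^bold>\<box> (\<^bold>\<box> Atom 0 \<^bold>\<longrightarrow> \<^bold>\<box> Atom 1) \<^bold>\<or> \<^bold>\<box> (\<^bold>\<box> Atom 1 \<^bold>\<longrightarrow> \<^bold>\<box> Atom 0) \<in> frame_logic R"
    unfolding frame_logic_def using assms by simp blast
qed

lemma normal_logic_Inter:
  assumes "\<And>L. L \<in> A \<Longrightarrow> normal_logic L"
  shows "normal_logic (\<Inter> A)"
  using assms unfolding normal_logic_def by blast

section \<open>Derivations in normal logics\<close>

lemma normal_logic_MP:
  assumes "normal_logic L" "\<phi> \<in> L" "(\<phi> \<^bold>\<longrightarrow> \<psi>) \<in> L"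
  shows "\<psi> \<in> L"
  using assms unfolding normal_logic_def by blast

lemma normal_logic_taut_MP:
  assumes "normal_logic L" "\<phi> \<in> L" "tautology (\<phi> \<^bold>\<longrightarrow> \<psi>)"
  shows "\<psi> \<in> L"
  using assms unfolding normal_logic_def by blast

lemma normal_logic_subst:
  assumes "normal_logic L" "\<phi> \<in> L"
  shows "subst \<sigma> \<phi> \<in> L"
  using assms unfolding normal_logic_def by blast

lemma normal_logic_Box_mono:
  assumes L: "normal_logic L" and taut: "tautology (\<phi> \<^bold>\<longrightarrow> \<psi>)"
  shows "(\<^bold>\<box> \<phi> \<^bold>\<longrightarrow> \<^bold>\<box> \<psi>) \<in> L"
proof -
  have "\<^bold>\<box> (\<phi> \<^bold>\<longrightarrow> \<psi>) \<in> L"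
    using L taut unfolding normal_logic_def by blast
  moreover have "(\<^bold>\<box> (\<phi> \<^bold>\<longrightarrow> \<psi>) \<^bold>\<longrightarrow> (\<^bold>\<box> \<phi> \<^bold>\<longrightarrow> \<^bold>\<box> \<psi>)) \<in> L"
  proof -
    have "(\<^bold>\<box> (Atom 0 \<^bold>\<longrightarrow> Atom 1) \<^bold>\<longrightarrow> (\<^bold>\<box> Atom 0 \<^bold>\<longrightarrow> \<^bold>\<box> Atom 1)) \<in> L"
      using L unfolding normal_logic_def by blast
    from normal_logic_subst[OF L this, of "\<lambda>i. if i = 0 then \<phi> else \<psi>"] show ?thesis
      by simp
  qed
  ultimately show ?thesis
    using L unfolding normal_logic_def by blast
qed

lemma normal_logic_K5_2: "normal_logic K5_2"
  unfolding K5_2_def by (rule normal_logic_smallest_logic)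

lemma K5_2_axiom: "(\<^bold>\<diamond> \<^bold>\<diamond> \<phi> \<^bold>\<longrightarrow> \<^bold>\<box> \<^bold>\<diamond> \<phi>) \<in> K5_2"
  using normal_logic_subst[OF normal_logic_K5_2, of "\<^bold>\<diamond> \<^bold>\<diamond> Atom 0 \<^bold>\<longrightarrow> \<^bold>\<box> \<^bold>\<diamond> Atom 0" "\<lambda>_. \<phi>"]
    axiom_in_smallest_logic unfolding K5_2_def by simp

text \<open>A successor refuting \<open>\<box>q \<rightarrow> \<box>p\<close> sees a point without \<open>p\<close>, so \<open>\<diamond>\<diamond>\<not>p\<close> holds; by the axiom
  of \<open>K5_2\<close> every successor then sees such a point, and \<open>\<box>p \<rightarrow> \<box>q\<close> holds vacuously at all of
  them.\<close>

lemma KU1_subset_K5_2: "KU1 \<subseteq> K5_2"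
  unfolding KU1_def
proof (intro smallest_logic_least normal_logic_K5_2)
  let ?r = "\<^bold>\<diamond> \<^bold>\<not> Atom 0"
  let ?X = "\<^bold>\<box> (\<^bold>\<box> Atom 0 \<^bold>\<longrightarrow> \<^bold>\<box> Atom 1)"
  let ?Y = "\<^bold>\<box> (\<^bold>\<box> Atom 1 \<^bold>\<longrightarrow> \<^bold>\<box> Atom 0)"
  have X: "(\<^bold>\<box> ?r \<^bold>\<longrightarrow> ?X) \<in> K5_2"
    by (rule normal_logic_Box_mono[OF normal_logic_K5_2]) (simp add: tautology_def)
  have Y: "(\<^bold>\<box> \<^bold>\<not> ?r \<^bold>\<longrightarrow> ?Y) \<in> K5_2"
    by (rule normal_logic_Box_mono[OF normal_logic_K5_2]) (auto simp: tautology_def)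
  have dual: "(\<^bold>\<diamond> ?r \<^bold>\<longleftrightarrow> \<^bold>\<not> \<^bold>\<box> \<^bold>\<not> ?r) \<in> K5_2"
  proof -
    have "(\<^bold>\<diamond> Atom 0 \<^bold>\<longleftrightarrow> \<^bold>\<not> \<^bold>\<box> \<^bold>\<not> Atom 0) \<in> K5_2"
      using normal_logic_K5_2 unfolding normal_logic_def by blast
    from normal_logic_subst[OF normal_logic_K5_2 this, of "\<lambda>_. ?r"] show ?thesis
      by simp
  qed
  show "?X \<^bold>\<or> ?Y \<in> K5_2"
    by (rule normal_logic_MP[OF normal_logic_K5_2 X],
        rule normal_logic_MP[OF normal_logic_K5_2 Y],
        rule normal_logic_MP[OF normal_logic_K5_2 dual],
        rule normal_logic_taut_MP[OF normal_logic_K5_2 K5_2_axiom[of "\<^bold>\<not> Atom 0"]])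
      (auto simp: tautology_def)
qed

section \<open>The line with a shortcut\<close>

definition shortcut :: "nat \<Rightarrow> nat \<Rightarrow> nat \<Rightarrow> bool" where
  "shortcut n x y \<longleftrightarrow> x = Suc y \<or> x = n + 2 \<and> y = 0"

definition weak5 :: "nat \<Rightarrow> fm" where
  "weak5 k = (Dia ^^ (k + 2)) (\<^bold>\<box> \<^bold>\<not> \<^bold>\<top>) \<^bold>\<longrightarrow> (\<^bold>\<diamond> \<^bold>\<diamond> Atom 0 \<^bold>\<longrightarrow> \<^bold>\<box> \<^bold>\<diamond> Atom 0)"

lemma KU1_subset_shortcut_logic: "KU1 \<subseteq> frame_logic (shortcut n)"
  by (rule KU1_subset_frame_logic) (auto simp: shortcut_def)

text \<open>The conclusion of \<open>weak5 k\<close> is itself the axiom of \<open>K5_2\<close>, so any premise would do here.\<close>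

lemma weak5_in_K5_2: "weak5 k \<in> K5_2"
  unfolding weak5_def
  by (rule normal_logic_taut_MP[OF normal_logic_K5_2 K5_2_axiom[of "Atom 0"]]) (simp add: tautology_def)

text \<open>Worlds below \<open>n + 2\<close> do not reach the shortcut, so the only path from such a world \<open>x\<close> to the
  dead end \<open>0\<close> is the one down the line, of length \<open>x\<close>.\<close>

lemma sat_Dia_power_dead_end:
  assumes "x < n + 2"
  shows "sat (shortcut n) V x ((Dia ^^ k) (\<^bold>\<box> \<^bold>\<not> \<^bold>\<top>)) \<longleftrightarrow> x = k"
  using assms
proof (induction k arbitrary: x)
  case 0
  then show ?case by (cases x) (auto simp: shortcut_def)
next
  case (Suc k)
  then show ?case by (cases x) (auto simp: shortcut_def)
qed

text \<open>The path through the shortcut has length \<open>1\<close>. The exponent \<open>k + 2\<close> rules it out, and only the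
  path along the line is detected.\<close>

lemma sat_Dia_power_at_shortcut:
  "sat (shortcut n) V (n + 2) ((Dia ^^ (k + 2)) (\<^bold>\<box> \<^bold>\<not> \<^bold>\<top>)) \<longleftrightarrow> k = n"
proof -
  have "sat (shortcut n) V (n + 2) ((Dia ^^ (k + 2)) (\<^bold>\<box> \<^bold>\<not> \<^bold>\<top>)) \<longleftrightarrow>
      (\<exists>y\<in>{n + 1, 0}. sat (shortcut n) V y ((Dia ^^ (k + 1)) (\<^bold>\<box> \<^bold>\<not> \<^bold>\<top>)))"
    by (auto simp: shortcut_def)
  also have "\<dots> \<longleftrightarrow> k = n"
    unfolding bex_simps using sat_Dia_power_dead_end[of "n + 1" n V "k + 1"]
      sat_Dia_power_dead_end[of 0 n V "k + 1"] by auto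
  finally show ?thesis .
qed

text \<open>At the failure point \<open>n + 2\<close> it is enough to make \<open>p\<close> true everywhere: then \<open>\<box>\<diamond>p\<close> fails
  because of the dead end \<open>0\<close>, while \<open>\<diamond>\<diamond>p\<close> holds by two steps along the line.\<close>

lemma weak5_in_shortcut_logic_iff: "weak5 k \<in> frame_logic (shortcut n) \<longleftrightarrow> k \<noteq> n"
proof
  assume valid: "weak5 k \<in> frame_logic (shortcut n)"
  show "k \<noteq> n"
  proof
    assume "k = n"
    define V where "V = (\<lambda>(i::nat) (x::nat). True)"
    have "sat (shortcut n) V (n + 2) (\<^bold>\<diamond> \<^bold>\<diamond> Atom 0)"
      by (auto simp: shortcut_def V_def)
    moreover have "\<not> sat (shortcut n) V (n + 2) (\<^bold>\<box> \<^bold>\<diamond> Atom 0)"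
      by (auto simp: shortcut_def V_def intro!: exI[of _ 0])
    moreover have "sat (shortcut n) V (n + 2) (weak5 k)"
      using valid by (simp add: frame_logic_def)
    ultimately show False
      using \<open>k = n\<close> sat_Dia_power_at_shortcut[of n V k] by (simp add: weak5_def del: funpow.simps)
  qed
next
  assume "k \<noteq> n"
  have "sat (shortcut n) V x (weak5 k)" for V x
  proof (cases "x = n + 2")
    case True
    then show ?thesis
      using \<open>k \<noteq> n\<close> sat_Dia_power_at_shortcut[of n V k] by (simp add: weak5_def)
  next
    case False
    \<comment> \<open>\<open>x\<close> has at most one successor, so \<open>\<diamond>\<diamond>p \<rightarrow> \<box>\<diamond>p\<close> cannot fail there.\<close>
    then have "sat (shortcut n) V x (\<^bold>\<diamond> \<^bold>\<diamond> Atom 0 \<^bold>\<longrightarrow> \<^bold>\<box> \<^bold>\<diamond> Atom 0)"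
      unfolding sat.simps shortcut_def by (metis Suc_inject)
    then show ?thesis by (simp add: weak5_def)
  qed
  then show "weak5 k \<in> frame_logic (shortcut n)"
    by (simp add: frame_logic_def)
qed

section \<open>Continuum-many logics\<close>

text \<open>Defining these logics as intersections, instead of adding axioms \<open>weak5 n\<close> to \<open>KU1\<close>, makes
  normality and the upper bound immediate and reduces the lower bound to the single components.\<close>

definition interval_logic :: "nat set \<Rightarrow> fm set" where
  "interval_logic S = \<Inter> (insert K5_2 ((\<lambda>n. frame_logic (shortcut n)) ` S))"

lemma normal_logic_interval_logic: "normal_logic (interval_logic S)"
  unfolding interval_logic_def
  by (rule normal_logic_Inter) (auto simp: normal_logic_K5_2 normal_logic_frame_logic)

lemma interval_logic_bounds: "KU1 \<subseteq> interval_logic S" "interval_logic S \<subseteq> K5_2"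
  using KU1_subset_K5_2 KU1_subset_shortcut_logic unfolding interval_logic_def by auto

lemma weak5_in_interval_logic_iff: "weak5 n \<in> interval_logic S \<longleftrightarrow> n \<notin> S"
  using weak5_in_K5_2 weak5_in_shortcut_logic_iff by (auto simp: interval_logic_def)

instance fm :: countable
  by countable_datatype

theorem mainTheorem8:
  "{L. normal_logic L \<and> KU1 \<subseteq> L \<and> L \<subseteq> K5_2} \<approx> (UNIV :: nat set set)"
proof (rule lepoll_antisym)
  have "inj_on (\<lambda>L. (to_nat :: fm \<Rightarrow> nat) ` L) A" for A
    by (rule inj_onI) (simp add: inj_image_eq_iff)
  then show "{L. normal_logic L \<and> KU1 \<subseteq> L \<and> L \<subseteq> K5_2} \<lesssim> (UNIV :: nat set set)"
    unfolding lepoll_def by blast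
next
  have "inj interval_logic"
    using weak5_in_interval_logic_iff by (intro injI) blast
  moreover have "range interval_logic \<subseteq> {L. normal_logic L \<and> KU1 \<subseteq> L \<and> L \<subseteq> K5_2}"
    using normal_logic_interval_logic interval_logic_bounds by blast
  ultimately show "(UNIV :: nat set set) \<lesssim> {L. normal_logic L \<and> KU1 \<subseteq> L \<and> L \<subseteq> K5_2}"
    unfolding lepoll_def by blast
qed

end
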